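(* For every integer $d\ge 1$ and all positive integers $n_1,\ldots,n_d$, the grid graph $P_{n_1}\square P_{n_2}\square\cdots\square P_{n_d}$ is a $\lceil d/2\rceil$-OR-PCG.
   Context: All graphs are finite, simple, undirected, with nonempty vertex set. A weighted tree is a finite tree with strictly positive real edge weights. For a weighted tree $T$ and vertices $x,y$ of $T$, $d_T(x,y)$ is the total weight of the unique $x$–$y$ path, and $L(T)$ is the set of leaves of $T$ (the vertex of a one-vertex tree counts as a leaf). Grid graph: for positive integers $n_1,\ldots,n_d$, the graph $P_{n_1}\square\cdots\square P_{n_d}$ has vertex set $\{(x_1,\ldots,x_d)\in\mathbb{Z}^d: 0\le x_i\le n_i-1 \text{ for every } i\in\{1,\ldots,d\}\}$; two vertices are adjacent if and only if they differ by $1$ in exactly one coordinate and agree in every other coordinate. PCG (pairwise compatibility graph): a graph $G=(V,E)$ is a PCG if there exist a weighted tree $T$, a bijection $\zeta:V\to L(T)$, and real numbers $0\le d_{\min}\le d_{\max}$ such that for every pair of distinct vertices $u,v\in V$, $uv\in E$ if and only if $d_{\min}\le d_T(\zeta(u),\zeta(v))\le d_{\max}$. $k$-OR-PCG ($k\ge 1$): a graph $G=(V,E)$ is a $k$-OR-PCG if there exist PCGs $G_i=(V,E_i)$, $1\le i\le k$, on the same vertex set $V$, such that $E=E_1\cup E_2\cup\cdots\cup E_k$. *)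

theory Defs
  imports "Graph_Theory.Graph_Theory" "HOL-Library.FuncSet"
begin

text \<open>
  Undirected graphs are represented as symmetric digraphs, the convention of \<open>Graph_Theory\<close>:
  an edge between \<open>x\<close> and \<open>y\<close> is the pair of arcs \<open>(x, y)\<close> and \<open>(y, x)\<close>.
  \<open>pair_graph\<close> is the locale of finite, loop-free, symmetric graphs without multiple edges.
\<close>

definition simple_graph :: "'a pair_pre_digraph \<Rightarrow> bool" where
  "simple_graph G \<longleftrightarrow> pair_graph G \<and> pverts G \<noteq> {}"

text \<open>
  The constant \<open>tree\<close> of \<open>Graph_Theory\<close> forbids all directed cycles, hence also the closed walk
  \<open>x, y, x\<close> along a single undirected edge.  An undirected cycle is a directed one
  of length at least 3.
\<close>

definition undirected_tree :: "'a pair_pre_digraph \<Rightarrow> bool" where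
  "undirected_tree T \<longleftrightarrow>
     simple_graph T \<and> connected (with_proj T) \<and>
     \<not> (\<exists>p. pre_digraph.cycle (with_proj T) p \<and> 3 \<le> length p)"

text \<open>The two arcs representing an edge carry the same weight.\<close>

definition weighted_tree :: "'a pair_pre_digraph \<Rightarrow> ('a \<times> 'a) weight_fun \<Rightarrow> bool" where
  "weighted_tree T w \<longleftrightarrow>
     undirected_tree T \<and> (\<forall>(x, y) \<in> parcs T. 0 < w (x, y) \<and> w (x, y) = w (y, x))"

definition tree_dist ::
    "'a pair_pre_digraph \<Rightarrow> ('a \<times> 'a) weight_fun \<Rightarrow> 'a \<Rightarrow> 'a \<Rightarrow> real" where
  "tree_dist T w x y =
     wf_digraph.awalk_cost w (THE p. pre_digraph.apath (with_proj T) x p y)"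

definition leaves :: "'a pair_pre_digraph \<Rightarrow> 'a set" where
  "leaves T = {v \<in> pverts T. out_degree (with_proj T) v = 1 \<or> pverts T = {v}}"

text \<open>
  Trees are finite, so taking their vertices among the natural numbers loses no generality
  up to isomorphism.
\<close>

definition PCG :: "'a pair_pre_digraph \<Rightarrow> bool" where
  "PCG G \<longleftrightarrow>
     simple_graph G \<and>
     (\<exists>(T :: nat pair_pre_digraph) w \<zeta> d_min d_max.
        weighted_tree T w \<and> bij_betw \<zeta> (pverts G) (leaves T) \<and>
        0 \<le> d_min \<and> d_min \<le> d_max \<and>
        (\<forall>u \<in> pverts G. \<forall>v \<in> pverts G. u \<noteq> v \<longrightarrow>
           ((u, v) \<in> parcs G \<longleftrightarrow>
              d_min \<le> tree_dist T w (\<zeta> u) (\<zeta> v) \<and> tree_dist T w (\<zeta> u) (\<zeta> v) \<le> d_max)))"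

definition OR_PCG :: "nat \<Rightarrow> 'a pair_pre_digraph \<Rightarrow> bool" where
  "OR_PCG k G \<longleftrightarrow>
     1 \<le> k \<and> simple_graph G \<and>
     (\<exists>H :: nat \<Rightarrow> 'a pair_pre_digraph.
        (\<forall>i \<in> {1..k}. PCG (H i) \<and> pverts (H i) = pverts G) \<and>
        parcs G = (\<Union>i \<in> {1..k}. parcs (H i)))"

text \<open>
  Points of the \<open>d\<close>-dimensional integer lattice are functions on \<open>{1..d}\<close>, made
  unique by extensionality outside that set.
\<close>

definition grid_verts :: "nat \<Rightarrow> (nat \<Rightarrow> nat) \<Rightarrow> (nat \<Rightarrow> int) set" where
  "grid_verts d n = (\<Pi>\<^sub>E i \<in> {1..d}. {0..int (n i) - 1})"

definition grid_graph :: "nat \<Rightarrow> (nat \<Rightarrow> nat) \<Rightarrow> (nat \<Rightarrow> int) pair_pre_digraph" where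
  "grid_graph d n =
     \<lparr> pverts = grid_verts d n,
       parcs = {(x, y). x \<in> grid_verts d n \<and> y \<in> grid_verts d n \<and>
                  (\<exists>i \<in> {1..d}. \<bar>x i - y i\<bar> = 1 \<and> (\<forall>j \<in> {1..d} - {i}. x j = y j))} \<rparr>"

end

theory Submission
  imports Defs
begin

text \<open>
  Pair up the coordinates. The edges of the grid in two fixed directions form a disjoint union
  of copies of a two-dimensional grid, and any such union is a PCG: with \<open>s = a + b\<close> and
  \<open>t = a - b\<close>, two points of the plane are adjacent iff \<open>s\<close> and \<open>t\<close> both change by 1.
  Use a caterpillar whose leaf \<open>v\<close> hangs at position \<open>s v\<close> of the spine (shifted far away
  for each copy) at height \<open>M + K + C * t v\<close> if \<open>s v\<close> is even and \<open>M - K - C * t v\<close>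
  if it is odd. For large \<open>K\<close> only pairs of opposite parity matter; their distance is
  \<open>2 * M + \<bar>s u - s v\<bar> + C * (t u - t v)\<close>, which for small \<open>C\<close> lies within \<open>C\<close> of
  \<open>2 * M + 1\<close> exactly for adjacent pairs.
\<close>

section \<open>Trees given by a parent function, and their path metric\<close>

text \<open>The vertices are \<open>0, ..., N - 1\<close> with root \<open>0\<close>. Numbering
  parents below their children rules out cycles and lets statements about paths be proved by
  induction on vertex numbers.\<close>

locale parent_tree =
  fixes par :: "nat \<Rightarrow> nat" and N :: nat
  assumes par_less: "\<And>i. 0 < i \<Longrightarrow> i < N \<Longrightarrow> par i < i"
    and pos: "0 < N"
begin

definition T :: "nat pair_pre_digraph" where
  "T = \<lparr> pverts = {..<N},
         parcs = {(i, j). i < N \<and> j < N \<and> (0 < i \<and> j = par i \<or> 0 < j \<and> i = par j)} \<rparr>"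

lemma pverts_T: "pverts T = {..<N}"
  by (simp add: T_def)

lemma parcs_T:
  "(i, j) \<in> parcs T \<longleftrightarrow> i < N \<and> j < N \<and> (0 < i \<and> j = par i \<or> 0 < j \<and> i = par j)"
  by (simp add: T_def)

sublocale pair_graph T
proof
  show "finite (parcs T)"
    by (rule finite_subset[of _ "{..<N} \<times> {..<N}"]) (auto simp: T_def)
  show "symmetric (with_proj T)"
    by (auto simp: symmetric_def parcs_T intro: symI)
  show "fst e \<noteq> snd e" if "e \<in> parcs T" for e
    using that par_less[of "fst e"] par_less[of "snd e"] by (cases e) (auto simp: parcs_T)
qed (auto simp: T_def)

lemma reachable_0: "x < N \<Longrightarrow> x \<rightarrow>\<^sup>*\<^bsub>with_proj T\<^esub> 0"
proof (induction x rule: less_induct)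
  case (less x)
  show ?case
  proof (cases "x = 0")
    case True
    then show ?thesis using pos by (simp add: reachable_refl pverts_T)
  next
    case False
    have "(x, par x) \<in> parcs T" "par x < x" "par x < N"
      using False less.prems par_less[of x] by (auto simp: parcs_T)
    then show ?thesis using adj_reachable_trans less.IH by blast
  qed
qed

lemma reachable: "x < N \<Longrightarrow> y < N \<Longrightarrow> x \<rightarrow>\<^sup>*\<^bsub>with_proj T\<^esub> y"
  by (rule reachable_trans[OF reachable_0 symmetric_reachable[OF sym_arcs reachable_0]])

lemma connected_T: "connected (with_proj T)"
proof (rule connectedI)
  show "pverts T \<noteq> {}" using pos by (auto simp: pverts_T)
  show "u \<rightarrow>\<^sup>*\<^bsub>with_proj (mk_symmetric (with_proj T))\<^esub> v"
    if "u \<in> pverts T" "v \<in> pverts T" for u v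
    using that reachable sym_arcs by (simp add: reachable_mk_symmetric_eq pverts_T)
qed

text \<open>A path that moves away from the root can never turn back.\<close>

lemma descending_apath:
  assumes "apath x ((x, z) # p) y" and "x < z"
  shows "x < y"
  using assms
proof (induction p arbitrary: x z)
  case Nil
  then show ?case by (auto simp: apath_simps)
next
  case (Cons e p)
  obtain z' where e: "e = (z, z')"
    using Cons.prems by (cases e) (auto simp: apath_simps)
  have arcs: "(x, z) \<in> parcs T" "(z, z') \<in> parcs T" "x \<noteq> z'"
    using Cons.prems by (auto simp: apath_simps e hd_in_awalk_verts)
  have "par z = x"
    using arcs(1) Cons.prems(2) par_less[of x] by (auto simp: parcs_T)
  \<comment> \<open>The parent \<open>x\<close> of \<open>z\<close> already lies on the path, so the
    second arc can only lead to a child of \<open>z\<close>.\<close>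
  then have "par z' = z" "0 < z'" "z' < N"
    using arcs by (auto simp: parcs_T)
  then have "z < z'" using par_less by blast
  moreover have "apath z ((z, z') # p) y"
    using Cons.prems by (auto simp: apath_simps e)
  ultimately have "z < y" using Cons.IH by blast
  then show ?case using Cons.prems by simp
qed

text \<open>A first step to a child would force the path to end above \<open>x\<close>, so the first
  step goes to the parent. This peels off one arc in the inductions below.\<close>

lemma apath_to_smaller:
  assumes "apath x p y" and "y < x"
  obtains q where "p = (x, par x) # q" "apath (par x) q y" "x < N"
proof -
  obtain z q where p: "p = (x, z) # q"
    using assms by (cases p) (auto simp: apath_simps)
  have arc: "(x, z) \<in> parcs T" and q: "apath z q y"
    using assms by (auto simp: apath_simps p)
  have "\<not> x < z"
    using descending_apath[of x z q y] assms p by force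
  then have "z = par x" "x < N"
    using arc par_less[of z] by (auto simp: parcs_T)
  then show ?thesis using that p q by blast
qed

text \<open>The first arc at the larger endpoint is forced, so two paths share it and induction on
  \<open>x + y\<close> applies. If \<open>y\<close> is the larger endpoint, both paths are reversed
  first.\<close>

lemma apath_unique:
  assumes "apath x p y" and "apath x q y"
  shows "p = q"
  using assms
proof (induction "x + y" arbitrary: x y p q rule: less_induct)
  case less
  have smaller: "p' = q'"
    if h: "apath x' p' y'" "apath x' q' y'" "y' < x'" "x' + y' = x + y" for x' y' p' q'
  proof -
    obtain r where r: "p' = (x', par x') # r" "apath (par x') r y'" "x' < N"
      by (rule apath_to_smaller[OF h(1,3)])
    obtain s where s: "q' = (x', par x') # s" "apath (par x') s y'"
      by (rule apath_to_smaller[OF h(2,3)])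
    have "par x' < x'" using par_less h(3) r(3) by auto
    then show ?thesis using less.hyps[of "par x'" y' r s] h(4) r s by simp
  qed
  consider "x = y" | "y < x" | "x < y" by linarith
  then show ?case
  proof cases
    case 1
    then show ?thesis using less.prems apath_nonempty_ends by blast
  next
    case 2
    then show ?thesis using smaller less.prems by blast
  next
    case 3
    then have "rev_path p = rev_path q"
      using smaller[of y "rev_path p" x "rev_path q"] less.prems by simp
    then show ?thesis by (simp add: rev_path_eq)
  qed
qed

text \<open>Removing the first arc of a cycle leaves a simple path joining the ends of an edge. By
  uniqueness this path is the reversed arc alone, so the cycle has length 2.\<close>

lemma undirected_tree_T: "undirected_tree T"
proof -
  have False if h: "cycle p" "3 \<le> length p" for p
  proof -
    obtain u where u: "awalk u p u" "distinct (tl (awalk_verts u p))"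
      using h by (auto simp: cycle_def)
    obtain e q where p: "p = e # q" using h by (cases p) auto
    have "e \<in> parcs T" "fst e = u" and q: "apath (snd e) q u"
      using u by (auto simp: p awalk_Cons_iff apath_def)
    then have "(snd e, u) \<in> parcs T" "snd e \<noteq> u" "u \<in> pverts T"
      using arcs_symmetric[of "fst e" "snd e"] no_loops[of e] wellformed by auto
    then have "apath (snd e) [(snd e, u)] u" by (auto simp: apath_simps)
    then have "q = [(snd e, u)]" using apath_unique q by blast
    then show False using h p by simp
  qed
  moreover have "pverts T \<noteq> {}" using pos by (auto simp: pverts_T)
  ultimately show ?thesis
    using connected_T pair_graph by (auto simp: undirected_tree_def simple_graph_def)
qed

text \<open>Every edge joins some \<open>i\<close> to \<open>par i < i\<close>, so its larger end
  identifies it: \<open>w i\<close> is the weight of the edge from \<open>i\<close> to its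
  parent.\<close>

definition arc_weight :: "(nat \<Rightarrow> real) \<Rightarrow> (nat \<times> nat) weight_fun" where
  "arc_weight w = (\<lambda>(i, j). w (max i j))"

lemma weighted_tree_T:
  assumes "\<And>i. i < N \<Longrightarrow> 0 < w i"
  shows "weighted_tree T (arc_weight w)"
proof -
  have "0 < arc_weight w (i, j) \<and> arc_weight w (i, j) = arc_weight w (j, i)"
    if "(i, j) \<in> parcs T" for i j
    using that assms[of "max i j"] by (simp add: arc_weight_def parcs_T max.commute)
  then show ?thesis
    using undirected_tree_T by (auto simp: weighted_tree_def)
qed

lemma awalk_cost_rev_path:
  "awalk_cost (arc_weight w) (rev_path p) = awalk_cost (arc_weight w) p"
proof (induction p)
  case (Cons e p)
  then show ?case by (cases e) (simp add: arc_weight_def max.commute)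
qed simp

text \<open>Peeling the arc at the larger endpoint gives the path cost the same recursion as
  \<open>D\<close>. Distances can thus be computed by guessing a formula and checking it on parents,
  without exhibiting any path.\<close>

lemma awalk_cost_apath:
  fixes D :: "nat \<Rightarrow> nat \<Rightarrow> real"
  assumes refl: "\<And>x. D x x = 0"
    and sym: "\<And>x y. D x y = D y x"
    and step: "\<And>x i. x < i \<Longrightarrow> i < N \<Longrightarrow> D x i = D x (par i) + w i"
    and "apath x p y"
  shows "awalk_cost (arc_weight w) p = D x y"
  using \<open>apath x p y\<close>
proof (induction "x + y" arbitrary: x y p rule: less_induct)
  case less
  have smaller: "awalk_cost (arc_weight w) p' = D x' y'"
    if h: "apath x' p' y'" "y' < x'" "x' + y' = x + y" for x' y' p'
  proof -
    obtain r where r: "p' = (x', par x') # r" "apath (par x') r y'" "x' < N"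
      by (rule apath_to_smaller[OF h(1,2)])
    have "par x' < x'" using par_less h r by auto
    then show ?thesis
      using less.hyps[of "par x'" y' r] h r step[of y' x'] sym
      by (simp add: arc_weight_def max_def)
  qed
  consider "x = y" | "y < x" | "x < y" by linarith
  then show ?case
  proof cases
    case 1
    then have "p = []" using less.prems apath_nonempty_ends by blast
    then show ?thesis using 1 refl by simp
  next
    case 2
    then show ?thesis using smaller less.prems by blast
  next
    case 3
    then show ?thesis
      using smaller[of y "rev_path p" x] less.prems sym[of x y] by (simp add: awalk_cost_rev_path)
  qed
qed

lemma tree_dist_T:
  fixes D :: "nat \<Rightarrow> nat \<Rightarrow> real"
  assumes "\<And>x. D x x = 0"
    and "\<And>x y. D x y = D y x"
    and "\<And>x i. x < i \<Longrightarrow> i < N \<Longrightarrow> D x i = D x (par i) + w i"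
    and "x < N" "y < N"
  shows "tree_dist T (arc_weight w) x y = D x y"
proof -
  obtain p where p: "apath x p y"
    using reachable[OF assms(4,5)] unfolding reachable_apath by blast
  then have "(THE p. apath x p y) = p"
    using apath_unique by blast
  then show ?thesis
    unfolding tree_dist_def using awalk_cost_apath[of D w, OF assms(1-3) p] by simp
qed

end

section \<open>Pairwise compatibility graphs from caterpillars\<close>

text \<open>Treated separately because the caterpillar below needs at least two pendant
  vertices.\<close>

lemma PCG_singleton:
  assumes "simple_graph G" and "pverts G = {v}"
  shows "PCG G"
proof -
  interpret parent_tree id "Suc 0" by unfold_locales auto
  have "leaves T = {0}"
    by (auto simp: leaves_def pverts_T)
  then have "bij_betw (\<lambda>_. 0) (pverts G) (leaves T)"
    using assms(2) by (auto simp: bij_betw_def)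
  moreover have "weighted_tree T (arc_weight (\<lambda>_. 1))"
    by (rule weighted_tree_T) simp
  ultimately show ?thesis
    unfolding PCG_def using assms by (intro conjI exI[of _ T] exI) auto
qed

lemma out_degree_neq_1:
  assumes "(i, j) \<in> parcs G" "(i, k) \<in> parcs G" "j \<noteq> k"
  shows "out_degree (with_proj G) i \<noteq> 1"
proof
  assume "out_degree (with_proj G) i = 1"
  then obtain e where "out_arcs (with_proj G) i = {e}"
    unfolding out_degree_def by (rule card_1_singletonE)
  moreover have "(i, j) \<in> out_arcs (with_proj G) i" "(i, k) \<in> out_arcs (with_proj G) i"
    using assms by auto
  ultimately show False using assms(3) by auto
qed

text \<open>The tree has a spine of unit edges, and \<open>v\<close> is a leaf hanging at spine
  position \<open>p v\<close> on an edge of weight \<open>h v\<close>. The path between two leaves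
  runs down one leg, along the spine and up the other leg.\<close>

lemma PCG_caterpillar:
  fixes p :: "'a \<Rightarrow> int" and h :: "'a \<Rightarrow> real"
  assumes G: "simple_graph G"
    and h: "\<And>v. v \<in> pverts G \<Longrightarrow> 0 < h v"
    and d: "0 \<le> d_min" "d_min \<le> d_max"
    and adj: "\<And>u v. u \<in> pverts G \<Longrightarrow> v \<in> pverts G \<Longrightarrow> u \<noteq> v \<Longrightarrow>
      (u, v) \<in> parcs G \<longleftrightarrow>
        d_min \<le> \<bar>p u - p v\<bar> + h u + h v \<and> \<bar>p u - p v\<bar> + h u + h v \<le> d_max"
  shows "PCG G"
proof (cases "\<exists>v. pverts G = {v}")
  case True
  then obtain v where "pverts G = {v}" by blast
  then show ?thesis using PCG_singleton[OF G] by simp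
next
  case False
  let ?V = "pverts G"
  interpret G: pair_graph G
    using G by (simp add: simple_graph_def)
  have ne: "?V \<noteq> {}" and fin: "finite ?V"
    using G G.pair_finite_verts by (simp_all add: simple_graph_def)
  obtain f where f: "bij_betw f ?V {0..<card ?V}"
    using ex_bij_betw_finite_nat[OF fin] by blast
  define g where "g = inv_into ?V f"
  \<comment> \<open>Positions are translated so that the spine is exactly \<open>0, ..., P\<close>,
    with a leg attached at each of its two ends; otherwise an end of the spine would be an
    additional leaf.\<close>
  define lo where "lo = Min (p ` ?V)"
  define q where "q v = nat (p v - lo)" for v
  define P where "P = Max (q ` ?V)"
  define N where "N = P + 1 + card ?V"
  \<comment> \<open>The numbers above \<open>P\<close> are the pendant vertices:
    \<open>P + 1 + k\<close> belongs to the vertex of \<open>G\<close> that \<open>f\<close> numbers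
    \<open>k\<close>.\<close>
  define par where "par i = (if i \<le> P then i - 1 else q (g (i - P - 1)))" for i
  define w where "w i = (if i \<le> P then 1 else h (g (i - P - 1)))" for i
  define \<zeta> where "\<zeta> v = P + 1 + f v" for v
  have "card ?V \<noteq> 0" "card ?V \<noteq> 1"
    using False ne fin by (auto simp: card_1_singleton_iff)
  then have "2 \<le> card ?V" by linarith
  \<comment> \<open>Two pendant vertices keep a spine consisting of a single vertex from being a
    leaf.\<close>
  then have N: "P + 3 \<le> N" by (simp add: N_def)
  have g_in: "g (i - P - 1) \<in> ?V" if "P < i" "i < N" for i
    using that bij_betw_inv_into[OF f] by (auto simp: g_def N_def bij_betw_def)
  have g_f: "g (f v) = v" if "v \<in> ?V" for v
    using that f by (simp add: g_def bij_betw_inv_into_left)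
  have q_le: "q v \<le> P" if "v \<in> ?V" for v
    using that fin by (simp add: P_def)
  have q: "int (q v) = p v - lo" if "v \<in> ?V" for v
    using that fin by (simp add: q_def lo_def)
  have \<zeta>: "P < \<zeta> v" "\<zeta> v < N" "par (\<zeta> v) = q v" "w (\<zeta> v) = h v" if "v \<in> ?V" for v
    using that bij_betwE[OF f] by (auto simp: \<zeta>_def N_def par_def w_def g_f)
  have par_le: "par i \<le> P" if "i < N" for i
    using that q_le g_in by (auto simp: par_def)
  have par_less: "par i < i" if "0 < i" "i < N" for i
    using that par_le[of i] by (auto simp: par_def split: if_splits)
  interpret parent_tree par N
    using par_less N by unfold_locales auto

  have bij: "bij_betw \<zeta> ?V {P<..<N}"
  proof -
    have "bij_betw (\<lambda>i. P + 1 + i) {0..<card ?V} {P<..<N}"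
      by (rule bij_betw_byWitness[where f' = "\<lambda>i. i - (P + 1)"]) (auto simp: N_def)
    moreover have "(\<lambda>i. P + 1 + i) \<circ> f = \<zeta>"
      by (simp add: \<zeta>_def fun_eq_iff)
    ultimately show ?thesis
      using bij_betw_trans[OF f] by metis
  qed
  have not_singleton: "{..<N} \<noteq> {i}" for i
  proof
    assume "{..<N} = {i}"
    then have "card {..<N} = card {i}" by (rule arg_cong)
    then show False using N by simp
  qed
  have leaves: "leaves T = {P<..<N}"
  proof (intro equalityI subsetI)
    fix i assume i: "i \<in> {P<..<N}"
    have arc: "(i, j) \<in> parcs T \<longleftrightarrow> j = par i" for j
    proof -
      have "j < N \<Longrightarrow> i \<noteq> par j" using i par_le[of j] by auto
      moreover have "par i < N" "0 < i" "i < N" using i par_le[of i] by auto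
      ultimately show ?thesis unfolding parcs_T by blast
    qed
    have "x \<in> out_arcs (with_proj T) i \<longleftrightarrow> x = (i, par i)" for x
      by (cases x) (use arc in \<open>simp, blast\<close>)
    then have "out_arcs (with_proj T) i = {(i, par i)}"
      by (simp add: set_eq_iff)
    then show "i \<in> leaves T"
      using i by (simp add: leaves_def out_degree_def pverts_T)
  next
    fix i assume "i \<in> leaves T"
    then have i: "i < N" and deg1: "out_degree (with_proj T) i = 1"
      using not_singleton by (simp_all add: leaves_def pverts_T)
    have deg: "j = k" if "(i, j) \<in> parcs T" "(i, k) \<in> parcs T" for j k
      by (rule ccontr) (use out_degree_neq_1[OF that] deg1 in simp)
    have pendant: "(q v, \<zeta> v) \<in> parcs T" if "v \<in> ?V" for v
      using \<zeta>[OF that] q_le[OF that] by (simp_all add: parcs_T)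
    have spine: "(j, Suc j) \<in> parcs T" "(Suc j, j) \<in> parcs T" if "j < P" for j
      using that N by (simp_all add: parcs_T par_def)
    have "P < i"
    proof (rule ccontr)
      assume "\<not> P < i"
      \<comment> \<open>Each spine vertex has two neighbours: two legs if it is the whole spine, a
        leg and a spine vertex at an end, two spine vertices in the interior.\<close>
      then consider "i = 0" "P = 0" | "i = 0" "0 < P" | "0 < P" "i = P" | "0 < i" "i < P"
        by linarith
      then show False
      proof cases
        case 1
        then have "(i, 1) \<in> parcs T" "(i, 2) \<in> parcs T"
          using N par_le[of 1] par_le[of 2] by (simp_all add: parcs_T)
        then show ?thesis using deg by force
      next
        case 2
        have "lo \<in> p ` ?V" using fin ne by (auto simp: lo_def)
        then obtain v where "v \<in> ?V" "q v = 0" by (auto simp: q_def)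
        then show ?thesis using deg[of 1 "\<zeta> v"] 2 spine[of 0] pendant[of v] \<zeta>(1)[of v] by simp
      next
        case 3
        have "P \<in> q ` ?V" using fin ne by (auto simp: P_def)
        then obtain v where "v \<in> ?V" "q v = P" by auto
        then show ?thesis
          using deg[of "P - 1" "\<zeta> v"] 3 spine[of "P - 1"] pendant[of v] \<zeta>(1)[of v] by simp
      next
        case 4
        then show ?thesis using deg[of "i - 1" "Suc i"] spine[of "i - 1"] spine[of i] by simp
      qed
    qed
    then show "i \<in> {P<..<N}" using i by simp
  qed

  \<comment> \<open>\<open>pos\<close> is the projection to the spine and \<open>ht\<close> the
    height above it. The diagonal of \<open>D\<close> is set apart because the formula would put a
    pendant vertex at twice its height from itself.\<close>
  define pos ht where "pos i = (if i \<le> P then i else par i)"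
    and "ht i = (if i \<le> P then 0 else w i)" for i
  define D where "D x y = (if x = y then 0 else \<bar>real (pos x) - real (pos y)\<bar> + ht x + ht y)" for x y
  have tree_dist: "tree_dist T (arc_weight w) x y = D x y" if "x < N" "y < N" for x y
  proof (rule tree_dist_T[OF _ _ _ that])
    show "D x i = D x (par i) + w i" if "x < i" "i < N" for x i
    proof (cases "i \<le> P")
      case True
      then show ?thesis using that by (auto simp: D_def pos_def ht_def par_def w_def of_nat_diff)
    next
      case False
      have "pos (par i) = par i" "ht (par i) = 0" "pos i = par i" "ht i = w i"
        using False par_le[OF that(2)] by (auto simp: pos_def ht_def)
      then show ?thesis
        using that by (auto simp: D_def)
    qed
  qed (auto simp: D_def)
  have dist: "tree_dist T (arc_weight w) (\<zeta> u) (\<zeta> v) = \<bar>p u - p v\<bar> + h u + h v"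
    if "u \<in> ?V" "v \<in> ?V" "u \<noteq> v" for u v
  proof -
    have "\<zeta> u \<noteq> \<zeta> v"
      using that bij by (auto simp: bij_betw_def inj_on_def)
    moreover have "real (q u) - real (q v) = real_of_int (p u - p v)"
      using q[OF that(1)] q[OF that(2)] by linarith
    ultimately show ?thesis
      using \<zeta>[OF that(1)] \<zeta>[OF that(2)] by (simp add: tree_dist D_def pos_def ht_def)
  qed
  have "weighted_tree T (arc_weight w)"
    using h g_in by (intro weighted_tree_T) (auto simp: w_def)
  then show ?thesis
    unfolding PCG_def using G d bij adj dist
    by (intro conjI exI[of _ T] exI[of _ "arc_weight w"] exI[of _ \<zeta>] exI[of _ d_min] exI[of _ d_max])
      (auto simp: leaves)
qed

section \<open>Disjoint unions of planar grids\<close>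

text \<open>The label \<open>c\<close> names the copy, and \<open>a\<close>, \<open>b\<close> are
  coordinates within it. Stating this through functions allows the remaining coordinates of a
  higher-dimensional grid to serve as the label.\<close>

lemma PCG_disjoint_grids:
  fixes a b :: "'a \<Rightarrow> int" and c :: "'a \<Rightarrow> 'b"
  assumes G: "simple_graph G"
    and adj: "\<And>u v. u \<in> pverts G \<Longrightarrow> v \<in> pverts G \<Longrightarrow>
      (u, v) \<in> parcs G \<longleftrightarrow> c u = c v \<and> \<bar>a u - a v\<bar> + \<bar>b u - b v\<bar> = 1"
  shows "PCG G"
proof -
  let ?V = "pverts G"
  interpret G: pair_graph G
    using G by (simp add: simple_graph_def)
  have fin: "finite ?V" by (rule G.pair_finite_verts)
  obtain e :: "'b \<Rightarrow> nat" where e: "inj_on e (c ` ?V)"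
    using finite_imp_inj_to_nat_seg[of "c ` ?V"] fin by blast
  \<comment> \<open>A sum of absolute values is a convenient common bound for its terms;
    \<open>K\<close> below is built the same way.\<close>
  define B where "B = (\<Sum>v\<in>?V. \<bar>a v\<bar> + \<bar>b v\<bar>)"
  have ab: "\<bar>a v\<bar> + \<bar>b v\<bar> \<le> B" if "v \<in> ?V" for v
    unfolding B_def using that fin by (intro member_le_sum) auto
  have "0 \<le> B" unfolding B_def by (intro sum_nonneg) simp
  define s t where "s v = a v + b v" and "t v = a v - b v" for v
  \<comment> \<open>The factor is even so that \<open>p\<close> keeps the parity of \<open>s\<close>, and large enough
    to separate different copies.\<close>
  define p where "p v = s v + (2 * B + 4) * int (e (c v))" for v
  define K where "K = (\<Sum>v\<in>?V. \<bar>p v\<bar>)"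
  have pK: "\<bar>p v\<bar> \<le> K" if "v \<in> ?V" for v
    unfolding K_def using that fin by (intro member_le_sum) auto
  have "0 \<le> K" unfolding K_def by (intro sum_nonneg) simp
  \<comment> \<open>Since \<open>t\<close> varies by at most \<open>2 * B\<close>, this choice keeps
    \<open>C * (t u - t v)\<close> within \<open>1 - C\<close> in absolute value.\<close>
  define C :: real where "C = 1 / (2 * B + 1)"
  have C: "0 < C" "C * (2 * B + 1) = 1"
    using \<open>0 \<le> B\<close> by (simp_all add: C_def)
  have C1: "C \<le> 1" using C \<open>0 \<le> B\<close> by (simp add: C_def)
  \<comment> \<open>Two more than \<open>K + 5\<close>, so that the heights at odd
    \<open>s v\<close> remain at least 1.\<close>
  define M :: real where "M = K + 7"
  \<comment> \<open>On a pair of opposite parity the summand \<open>K + 5\<close> cancels; on a pair of equal parity it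
    pushes the distance out of the interval.\<close>
  define h :: "'a \<Rightarrow> real"
    where "h v = (if even (s v) then M + (K + 5) + C * t v else M - (K + 5) - C * t v)" for v
  have Ct: "\<bar>C * t v\<bar> \<le> 1" if "v \<in> ?V" for v
  proof -
    have "\<bar>t v\<bar> \<le> B" using ab[OF that] by (simp add: t_def)
    then have "C * \<bar>t v\<bar> \<le> C * (2 * B + 1)"
      using C(1) \<open>0 \<le> B\<close> by (intro mult_left_mono) simp_all
    then have "C * \<bar>t v\<bar> \<le> 1" using C(2) by linarith
    then show ?thesis using C(1) by (simp add: abs_mult)
  qed
  \<comment> \<open>The distance condition with \<open>2 * M\<close> subtracted, for an even and an
    odd point, where the terms \<open>K + 5\<close> have cancelled.\<close>
  have key: "(u, v) \<in> parcs G \<longleftrightarrow>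
      1 - C \<le> \<bar>p u - p v\<bar> + C * (t u - t v) \<and> \<bar>p u - p v\<bar> + C * (t u - t v) \<le> 1 + C"
    if u: "u \<in> ?V" and v: "v \<in> ?V" and parity: "even (s u)" "odd (s v)" for u v
  proof -
    have bounds: "\<bar>s u - s v\<bar> \<le> 2 * B" "\<bar>t u - t v\<bar> \<le> 2 * B"
      using ab[OF u] ab[OF v] by (simp_all add: s_def t_def)
    have "C * \<bar>t u - t v\<bar> \<le> C * (2 * B)"
      using bounds(2) C(1) by (intro mult_left_mono) linarith+
    also have "\<dots> = 1 - C" using C(2) by (simp add: algebra_simps)
    finally have small: "\<bar>C * (t u - t v)\<bar> \<le> 1 - C"
      using C(1) by (simp add: abs_mult)
    have p_iff: "\<bar>p u - p v\<bar> = 1 \<longleftrightarrow> c u = c v \<and> \<bar>s u - s v\<bar> = 1"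
    proof (cases "c u = c v")
      case False
      then have "e (c u) \<noteq> e (c v)" using e u v by (auto simp: inj_on_def)
      then have "1 \<le> \<bar>int (e (c u)) - int (e (c v))\<bar>" by simp
      then have "2 * B + 4 \<le> (2 * B + 4) * \<bar>int (e (c u)) - int (e (c v))\<bar>"
        using \<open>0 \<le> B\<close> by simp
      also have "\<dots> = \<bar>(2 * B + 4) * (int (e (c u)) - int (e (c v)))\<bar>"
        using \<open>0 \<le> B\<close> by (simp add: abs_mult)
      also have "\<dots> = \<bar>(p u - p v) - (s u - s v)\<bar>"
        by (simp add: p_def algebra_simps)
      \<comment> \<open>Different copies are at least \<open>(2 * B + 4) - 2 * B = 4\<close> apart
        on the spine.\<close>
      finally show ?thesis using bounds(1) False by linarith
    qed (simp add: p_def)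
    have "even (p u)" "odd (p v)" using parity by (simp_all add: p_def)
    then have p_odd: "odd \<bar>p u - p v\<bar>" by simp
    have t_iff: "\<bar>C * (t u - t v)\<bar> \<le> C \<longleftrightarrow> \<bar>t u - t v\<bar> = 1"
      if "\<bar>s u - s v\<bar> = 1"
    proof -
      have "\<bar>C * (t u - t v)\<bar> = C * \<bar>t u - t v\<bar>" using C(1) by (simp add: abs_mult)
      also have "\<dots> \<le> C \<longleftrightarrow> real_of_int \<bar>t u - t v\<bar> \<le> 1"
        using C(1) by simp
      also have "\<dots> \<longleftrightarrow> \<bar>t u - t v\<bar> \<le> 1" by linarith
      also have "\<dots> \<longleftrightarrow> \<bar>t u - t v\<bar> = 1"
      proof -
        \<comment> \<open>\<open>s\<close> and \<open>t\<close> agree modulo 2, so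
          \<open>t u\<close> and \<open>t v\<close> have opposite parity as well.\<close>
        have "t u \<noteq> t v"
        proof
          assume "t u = t v"
          then have "s u - s v = 2 * (b u - b v)" by (simp add: s_def t_def)
          then show False using parity by presburger
        qed
        then show ?thesis by linarith
      qed
      finally show ?thesis .
    qed
    have "(u, v) \<in> parcs G \<longleftrightarrow> c u = c v \<and> \<bar>s u - s v\<bar> = 1 \<and> \<bar>t u - t v\<bar> = 1"
    proof -
      have "\<bar>x\<bar> + \<bar>y\<bar> = 1 \<longleftrightarrow> \<bar>x + y\<bar> = 1 \<and> \<bar>x - y\<bar> = 1" for x y :: int
        by presburger
      moreover have "s u - s v = (a u - a v) + (b u - b v)" "t u - t v = (a u - a v) - (b u - b v)"
        by (simp_all add: s_def t_def)
      ultimately show ?thesis using adj[OF u v] by presburger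
    qed
    also have "\<dots> \<longleftrightarrow> \<bar>p u - p v\<bar> = 1 \<and> \<bar>C * (t u - t v)\<bar> \<le> C"
      using p_iff t_iff by blast
    also have "\<dots> \<longleftrightarrow> 1 - C \<le> \<bar>p u - p v\<bar> + C * (t u - t v) \<and>
        \<bar>p u - p v\<bar> + C * (t u - t v) \<le> 1 + C"
    proof (cases "\<bar>p u - p v\<bar> = 1")
      case False
      \<comment> \<open>An odd spine distance other than 1 is at least 3, and the \<open>t\<close>
        term lowers it by at most \<open>1 - C\<close>, leaving at least
        \<open>2 + C\<close>.\<close>
      then have "3 \<le> \<bar>p u - p v\<bar>" using p_odd by presburger
      then have "1 + C < \<bar>p u - p v\<bar> + C * (t u - t v)" using small by linarith
      then show ?thesis using False by simp
    qed auto
    finally show ?thesis .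
  qed
  show ?thesis
  proof (rule PCG_caterpillar[OF G])
    show "0 < h v" if "v \<in> ?V" for v
      using Ct[OF that] \<open>0 \<le> K\<close> by (auto simp: h_def M_def)
    show "0 \<le> 2 * M + 1 - C" "2 * M + 1 - C \<le> 2 * M + 1 + C"
      using C(1) C1 \<open>0 \<le> K\<close> by (simp_all add: M_def)
    fix u v assume u: "u \<in> ?V" and v: "v \<in> ?V" and "u \<noteq> v"
    have parity: "even (s u) \<longleftrightarrow> odd (s v)" if "(u, v) \<in> parcs G"
    proof -
      have "\<bar>a u - a v\<bar> + \<bar>b u - b v\<bar> = 1" using that adj[OF u v] by blast
      then show ?thesis unfolding s_def by presburger
    qed
    have sym: "(u, v) \<in> parcs G \<longleftrightarrow> (v, u) \<in> parcs G"
      by (blast intro: G.arcs_symmetric)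
    have bound: "real_of_int \<bar>p u - p v\<bar> \<le> 2 * real_of_int K"
      using pK[OF u] pK[OF v] by linarith
    consider "even (s u)" "odd (s v)" | "odd (s u)" "even (s v)"
      | "even (s u)" "even (s v)" | "odd (s u)" "odd (s v)" by blast
    then show "(u, v) \<in> parcs G \<longleftrightarrow>
        2 * M + 1 - C \<le> \<bar>p u - p v\<bar> + h u + h v \<and> \<bar>p u - p v\<bar> + h u + h v \<le> 2 * M + 1 + C"
    proof cases
      case 1
      then show ?thesis using key[OF u v 1] by (simp add: h_def algebra_simps)
    next
      case 2
      then show ?thesis
        using key[OF v u 2(2,1)] sym by (simp add: h_def algebra_simps abs_minus_commute)
    next
      case 3
      \<comment> \<open>Two even points have distance at least \<open>2 * M + 8\<close>, beyond the
        interval.\<close>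
      then have "h u + h v = 2 * M + 2 * real_of_int K + 10 + C * t u + C * t v" by (simp add: h_def)
      moreover have "0 \<le> real_of_int \<bar>p u - p v\<bar>" "0 \<le> real_of_int K"
        using \<open>0 \<le> K\<close> by simp_all
      ultimately have "2 * M + 1 + C < \<bar>p u - p v\<bar> + h u + h v"
        using Ct[OF u] Ct[OF v] C1 by linarith
      then show ?thesis using 3 parity by auto
    next
      case 4
      \<comment> \<open>The spine contributes at most \<open>2 * K\<close>, so two odd points have
        distance at most \<open>2 * M - 8\<close>, short of the interval.\<close>
      then have "h u + h v = 2 * M - 2 * real_of_int K - 10 - C * t u - C * t v" by (simp add: h_def)
      then have "\<bar>p u - p v\<bar> + h u + h v < 2 * M + 1 - C"
        using Ct[OF u] Ct[OF v] C1 bound by linarith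
      then show ?thesis using 4 parity by auto
    qed
  qed
qed

section \<open>Decomposition of the grid into pairs of directions\<close>

lemma simple_graphI:
  assumes "finite V" "V \<noteq> {}"
    and "\<And>x y. (x, y) \<in> A \<Longrightarrow> x \<in> V \<and> y \<in> V \<and> x \<noteq> y \<and> (y, x) \<in> A"
  shows "simple_graph \<lparr>pverts = V, parcs = A\<rparr>"
proof -
  have "finite A"
    by (rule finite_subset[of _ "V \<times> V"]) (use assms in auto)
  moreover have "sym A" by (rule symI) (use assms(3) in blast)
  ultimately have "pair_graph \<lparr>pverts = V, parcs = A\<rparr>"
    using assms by unfold_locales (auto simp: symmetric_def)
  then show ?thesis using assms(2) by (simp add: simple_graph_def)
qed

lemma finite_grid_verts: "finite (grid_verts d n)"
  by (simp add: grid_verts_def finite_PiE)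

lemma grid_verts_nonempty: "(\<And>i. i \<in> {1..d} \<Longrightarrow> 1 \<le> n i) \<Longrightarrow> grid_verts d n \<noteq> {}"
  unfolding grid_verts_def PiE_eq_empty_iff by force

text \<open>Only edges in the directions \<open>I\<close> are kept, but all vertices remain, because
  the graphs of an OR-PCG share one vertex set.\<close>

definition partial_grid ::
    "nat \<Rightarrow> (nat \<Rightarrow> nat) \<Rightarrow> nat set \<Rightarrow> (nat \<Rightarrow> int) pair_pre_digraph" where
  "partial_grid d n I =
     \<lparr> pverts = grid_verts d n,
       parcs = {(x, y). x \<in> grid_verts d n \<and> y \<in> grid_verts d n \<and>
                  (\<exists>i \<in> I. \<bar>x i - y i\<bar> = 1 \<and> (\<forall>j \<in> {1..d} - {i}. x j = y j))} \<rparr>"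

lemma grid_graph_eq_partial_grid: "grid_graph d n = partial_grid d n {1..d}"
  by (simp add: grid_graph_def partial_grid_def)

lemma simple_graph_partial_grid:
  assumes "\<And>i. i \<in> {1..d} \<Longrightarrow> 1 \<le> n i"
  shows "simple_graph (partial_grid d n I)"
  unfolding partial_grid_def
proof (rule simple_graphI[OF finite_grid_verts], goal_cases)
  case 1
  show ?case using grid_verts_nonempty assms by blast
next
  case (2 x y)
  then obtain i where "x \<in> grid_verts d n" "y \<in> grid_verts d n"
    and i: "i \<in> I" "\<bar>x i - y i\<bar> = 1" "\<forall>j \<in> {1..d} - {i}. x j = y j"
    by auto
  moreover have "\<bar>y i - x i\<bar> = 1" "\<forall>j \<in> {1..d} - {i}. y j = x j" "x \<noteq> y"
    using i by auto
  ultimately show ?case by blast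
qed

text \<open>Moving in two directions fixes all other coordinates, so their values label the copies
  of a planar grid.\<close>

lemma PCG_two_directions:
  assumes "\<And>i. i \<in> {1..d} \<Longrightarrow> 1 \<le> n i" and m: "1 \<le> m" "2 * m - 1 \<le> d"
  shows "PCG (partial_grid d n ({1..d} \<inter> {2 * m - 1, 2 * m}))"
proof (rule PCG_disjoint_grids[OF simple_graph_partial_grid[OF assms(1)]])
  define a :: "(nat \<Rightarrow> int) \<Rightarrow> int" where "a x = x (2 * m - 1)" for x
  \<comment> \<open>When \<open>d\<close> is odd, the last block has a single direction. The
    constant second coordinate 0 then makes the copies paths.\<close>
  define b :: "(nat \<Rightarrow> int) \<Rightarrow> int" where "b x = (if 2 * m \<le> d then x (2 * m) else 0)" for x
  define c :: "(nat \<Rightarrow> int) \<Rightarrow> nat \<Rightarrow> int"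
    where "c x = restrict x ({1..d} - {2 * m - 1, 2 * m})" for x
  fix x y assume "x \<in> pverts (partial_grid d n ({1..d} \<inter> {2 * m - 1, 2 * m}))" "y \<in> pverts (partial_grid d n ({1..d} \<inter> {2 * m - 1, 2 * m}))"
  then have "(x, y) \<in> parcs (partial_grid d n ({1..d} \<inter> {2 * m - 1, 2 * m})) \<longleftrightarrow>
      (\<exists>i \<in> {1..d} \<inter> {2 * m - 1, 2 * m}. \<bar>x i - y i\<bar> = 1 \<and> (\<forall>j \<in> {1..d} - {i}. x j = y j))"
    by (simp add: partial_grid_def)
  also have "\<dots> \<longleftrightarrow> c x = c y \<and> (\<bar>a x - a y\<bar> = 1 \<and> b x = b y \<or> a x = a y \<and> \<bar>b x - b y\<bar> = 1)"
  proof -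
    have c_eq: "c x = c y \<longleftrightarrow> (\<forall>j \<in> {1..d} - {2 * m - 1, 2 * m}. x j = y j)"
      by (auto simp: c_def fun_eq_iff restrict_def)
    have ne: "2 * m - 1 \<noteq> 2 * m" and m1: "2 * m - 1 \<in> {1..d}" using m by auto
    show ?thesis
    proof (cases "2 * m \<le> d")
      case True
      then have "2 * m \<in> {1..d}" using m by auto
      then show ?thesis
        unfolding c_eq a_def b_def using ne m1 True by (auto 0 4)
    next
      case False
      then have "2 * m \<notin> {1..d}" by auto
      then show ?thesis
        unfolding c_eq a_def b_def using ne m1 False by (auto 0 4)
    qed
  qed
  also have "\<dots> \<longleftrightarrow> c x = c y \<and> \<bar>a x - a y\<bar> + \<bar>b x - b y\<bar> = 1"
    by (rule conj_cong[OF refl]) linarith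
  finally show "(x, y) \<in> parcs (partial_grid d n ({1..d} \<inter> {2 * m - 1, 2 * m})) \<longleftrightarrow> c x = c y \<and> \<bar>a x - a y\<bar> + \<bar>b x - b y\<bar> = 1" .
qed

theorem theorem4p1:
  fixes d :: nat and n :: "nat \<Rightarrow> nat"
  assumes "1 \<le> d"
    and "\<And>i. i \<in> {1..d} \<Longrightarrow> 1 \<le> n i"
  shows "OR_PCG (nat \<lceil>real d / 2\<rceil>) (grid_graph d n)"
proof -
  have ceil: "nat \<lceil>real d / 2\<rceil> = (d + 1) div 2" by linarith
  \<comment> \<open>Blocks of two consecutive directions: direction \<open>i\<close> lies in block
    \<open>(i + 1) div 2\<close>, and the intersection removes \<open>d + 1\<close> from the last
    block when \<open>d\<close> is odd.\<close>
  define I where "I m = {1..d} \<inter> {2 * m - 1, 2 * m}" for m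
  have "PCG (partial_grid d n (I m))" if "m \<in> {1..(d + 1) div 2}" for m
    unfolding I_def using that by (intro PCG_two_directions assms(2)) auto
  moreover have "parcs (grid_graph d n) = (\<Union>m \<in> {1..(d + 1) div 2}. parcs (partial_grid d n (I m)))"
  proof -
    have "\<exists>m \<in> {1..(d + 1) div 2}. i \<in> I m" if "i \<in> {1..d}" for i
      by (rule bexI[of _ "(i + 1) div 2"]) (use that in \<open>auto simp: I_def\<close>)
    then have "{1..d} = (\<Union>m \<in> {1..(d + 1) div 2}. I m)"
      by (auto simp: I_def)
    then show ?thesis
      unfolding grid_graph_eq_partial_grid partial_grid_def by auto
  qed
  moreover have "pverts (partial_grid d n (I m)) = pverts (grid_graph d n)" for m
    by (simp add: partial_grid_def grid_graph_def)
  moreover have "1 \<le> (d + 1) div 2" using assms(1) by linarith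
  moreover have "simple_graph (grid_graph d n)"
    unfolding grid_graph_eq_partial_grid by (rule simple_graph_partial_grid) (rule assms(2))
  ultimately show ?thesis
    unfolding OR_PCG_def ceil by (intro conjI exI[of _ "\<lambda>m. partial_grid d n (I m)"] ballI)
qed

end
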